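(* Let $f\in C^4_p(\mathbb{R})$ and let $\tilde x$ be a critical point of $f$. Then, at $(\mu,\sigma)=(\tilde x,0)$, the linearization of the gradient flow $$\begin{bmatrix}\dot\mu\\ \dot\sigma\end{bmatrix}=-\nabla F(\mu,\sigma)$$ is $$\begin{bmatrix}\dot\mu\\ \dot\sigma\end{bmatrix}=-\begin{bmatrix}f''(\tilde x)&0\\0&f''(\tilde x)\end{bmatrix}\begin{bmatrix}\mu-\tilde x\\ \sigma\end{bmatrix}.$$ In particular, points $(\tilde x,0)$ corresponding to non-degenerate local maxima ($f''(\tilde x)<0$) are repelling, whereas those corresponding to non-degenerate local minima ($f''(\tilde x)>0$) are attractive.
   Context: $C^k_p(\mathbb{R})$ is the set of functions $f:\mathbb{R}\to\mathbb{R}$ with $k$ continuous derivatives such that for every $0\le j\le k$, $\lim_{|x|\to\infty}f^{(j)}(x)/|x|^m=0$ for some $m>0$. For $\mu\in\mathbb{R}$, $\sigma>0$, $\Gamma_{\mu,\sigma}(x)=\frac{1}{\sqrt{2\pi}\,\sigma}e^{-(x-\mu)^2/(2\sigma^2)}$ and $F(\mu,\sigma)=\int_{\mathbb{R}}f(x)\Gamma_{\mu,\sigma}(x)\,dx$. The flow is considered on $\{\sigma\ge0\}$, where $\nabla F$ (and, for the linearization, its first derivatives) at $\sigma=0$ are understood as the limits as $\sigma\to0^+$. *)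

theory Defs
  imports "HOL-Probability.Probability"
begin

definition Ckp :: "nat \<Rightarrow> (real \<Rightarrow> real) set" where
  "Ckp k = {f. (\<forall>j<k. (deriv ^^ j) f differentiable_on UNIV) \<and>
               (\<forall>j\<le>k. continuous_on UNIV ((deriv ^^ j) f) \<and>
                      (\<exists>m>0. ((\<lambda>x. (deriv ^^ j) f x / \<bar>x\<bar> powr m) \<longlongrightarrow> 0) at_infinity))}"

text \<open>Points of the parameter plane are vectors with components \<open>z $ 1 = \<mu>\<close> and \<open>z $ 2 = \<sigma>\<close>.
  For \<open>\<sigma> > 0\<close> the library's \<open>normal_density \<mu> \<sigma>\<close> is the kernel \<open>\<Gamma>\<close>; the value of the
  integral for \<open>\<sigma> \<le> 0\<close> is a junk value that is never used below.\<close>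

definition smoothing :: "(real \<Rightarrow> real) \<Rightarrow> real^2 \<Rightarrow> real" where
  "smoothing f z = (\<integral>x. f x * normal_density (z $ 1) (z $ 2) x \<partial>lborel)"

definition half_plane :: "(real^2) set" where
  "half_plane = {z. z $ 2 \<ge> 0}"

definition gradient :: "(real^2 \<Rightarrow> real) \<Rightarrow> real^2 \<Rightarrow> real^2" where
  "gradient F z = (THE D. GDERIV F z :> D)"

text \<open>The gradient on the closed half-plane: on the boundary it is the limit from inside along the
  vertical line. \<open>THE\<close> and \<open>Lim\<close> are total, so the existence of the gradient and of its boundary
  values is the separate property \<open>gradient_extends\<close>.\<close>

definition ext_gradient :: "(real^2 \<Rightarrow> real) \<Rightarrow> real^2 \<Rightarrow> real^2" where
  "ext_gradient F z =
     (if z $ 2 > 0 then gradient F z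
      else Lim (at_right 0) (\<lambda>\<sigma>. gradient F (vector [z $ 1, \<sigma>])))"

definition gradient_extends :: "(real^2 \<Rightarrow> real) \<Rightarrow> bool" where
  "gradient_extends F \<longleftrightarrow>
     (\<forall>\<mu> \<sigma>. \<sigma> > 0 \<longrightarrow> GDERIV F (vector [\<mu>, \<sigma>]) :> ext_gradient F (vector [\<mu>, \<sigma>])) \<and>
     (\<forall>\<mu>. ((\<lambda>\<sigma>. ext_gradient F (vector [\<mu>, \<sigma>])) \<longlongrightarrow> ext_gradient F (vector [\<mu>, 0])) (at_right 0))"

text \<open>The linearization of \<open>z' = V z\<close> at a boundary equilibrium \<open>p\<close> of the half-plane is
  \<open>z' = A *v (z - p)\<close>. The matrix \<open>A\<close> is the limit of the Jacobians \<open>J \<sigma>\<close> of \<open>V\<close> at \<open>(p $ 1, \<sigma>)\<close>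
  as \<open>\<sigma>\<close> tends to \<open>0\<close> from the right, and it is required to give the first-order approximation of
  \<open>V\<close> at \<open>p\<close> relative to the closed half-plane as well.\<close>

definition linearization_at :: "(real^2 \<Rightarrow> real^2) \<Rightarrow> real^2 \<Rightarrow> real^2^2 \<Rightarrow> bool" where
  "linearization_at V p A \<longleftrightarrow>
     V p = 0 \<and>
     (\<exists>J. (\<forall>\<sigma>>0. (V has_derivative (\<lambda>h. J \<sigma> *v h)) (at (vector [p $ 1, \<sigma>]))) \<and>
          (J \<longlongrightarrow> A) (at_right 0)) \<and>
     (V has_derivative (\<lambda>h. A *v h)) (at p within half_plane)"

definition forward_solution ::
  "(real^2 \<Rightarrow> real^2) \<Rightarrow> (real^2) set \<Rightarrow> real^2 \<Rightarrow> (real \<Rightarrow> real^2) \<Rightarrow> bool" where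
  "forward_solution V S z0 z \<longleftrightarrow>
     z 0 = z0 \<and>
     (\<forall>t\<ge>0. z t \<in> S \<and> (z has_vector_derivative V (z t)) (at t within {0..}))"

text \<open>An attracting point is an asymptotically stable equilibrium of the flow on \<open>S\<close>: it is
  Lyapunov stable and attracts a neighbourhood. The existence of global forward solutions from all
  nearby initial points is part of the definition, so that it cannot hold vacuously.\<close>

definition attracting :: "(real^2 \<Rightarrow> real^2) \<Rightarrow> (real^2) set \<Rightarrow> real^2 \<Rightarrow> bool" where
  "attracting V S p \<longleftrightarrow>
     p \<in> S \<and> V p = 0 \<and>
     (\<exists>\<delta>>0. \<forall>z0\<in>S \<inter> ball p \<delta>. \<exists>z. forward_solution V S z0 z) \<and>
     (\<forall>\<epsilon>>0. \<exists>\<delta>>0. \<forall>z0\<in>S \<inter> ball p \<delta>. \<forall>z. forward_solution V S z0 z \<longrightarrow>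
        (\<forall>t\<ge>0. z t \<in> ball p \<epsilon>)) \<and>
     (\<exists>\<delta>>0. \<forall>z0\<in>S \<inter> ball p \<delta>. \<forall>z. forward_solution V S z0 z \<longrightarrow>
        (z \<longlongrightarrow> p) at_top)"

text \<open>A repelling point is one that is attracting for the time-reversed flow.\<close>

definition repelling :: "(real^2 \<Rightarrow> real^2) \<Rightarrow> (real^2) set \<Rightarrow> real^2 \<Rightarrow> bool" where
  "repelling V S p \<longleftrightarrow> attracting (\<lambda>z. - V z) S p"

end

theory Submission
  imports Defs
begin

text \<open>For \<open>\<sigma> > 0\<close> one has \<open>F(\<mu>, \<sigma>) = E f(\<mu> + \<sigma> X)\<close> with \<open>X\<close> standard normal, and differentiation under
  the integral gives \<open>\<nabla>F = (E f'(\<mu> + \<sigma> X), E X f'(\<mu> + \<sigma> X))\<close>. The right-hand side makes sense for all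
  real \<open>\<sigma>\<close> and is a \<open>C\<^sup>1\<close> field on the plane, whose Jacobian has the entries
  \<open>E X\<^sup>k f''(\<mu> + \<sigma> X)\<close>, \<open>k = 0, 1, 2\<close>; at \<open>\<sigma> = 0\<close> it is \<open>f''(\<mu>)\<close> times the identity because the first
  two moments of \<open>X\<close> are \<open>0\<close> and \<open>1\<close>. Stability then follows with the squared distance to the
  equilibrium as a Lyapunov function. Since \<open>E X = 0\<close>, the second component of the field vanishes on
  \<open>\<sigma> = 0\<close>, so solutions do not leave the half-plane.\<close>

section \<open>Lipschitz differential equations and asymptotic stability\<close>

lemma integral_has_vector_derivative_halfline:
  fixes h :: "real \<Rightarrow> 'a::banach"
  assumes "continuous_on {0..} h" and "t \<ge> 0"
  shows "((\<lambda>u. integral {0..u} h) has_vector_derivative h t) (at t within {0..})"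
proof -
  \<comment> \<open>The right end \<open>t + 1\<close> leaves room beyond \<open>t\<close>, so the
    interval and the half-line agree near \<open>t\<close>.\<close>
  have "((\<lambda>u. integral {0..u} h) has_vector_derivative h t) (at t within {0..t + 1})"
    using assms by (intro integral_has_vector_derivative) (auto intro: continuous_on_subset)
  moreover have "at t within {0..t + 1} = at t within {0..}"
    by (rule at_within_nhd[where S = "{..<t + 1}"]) auto
  ultimately show ?thesis
    by simp
qed

text \<open>Integrating \<open>exp (K * s)\<close> gains a factor \<open>1 / K\<close>, and the
  weight \<open>exp (- K * t)\<close> cancels the remaining growth. Both boundedness and contraction
  of the weighted Picard operator come from this estimate.\<close>

lemma norm_integral_exp_le:
  fixes h :: "real \<Rightarrow> 'a::banach"
  assumes "K > 0" "B \<ge> 0" "t \<ge> 0" "continuous_on {0..} h"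
    and "\<And>s. s \<ge> 0 \<Longrightarrow> norm (h s) \<le> B * exp (K * s)"
  shows "exp (- K * t) * norm (integral {0..t} h) \<le> B / K"
proof -
  have "((\<lambda>s. B * exp (K * s)) has_integral (B / K * exp (K * t) - B / K * exp (K * 0))) {0..t}"
    using assms
    by (intro fundamental_theorem_of_calculus)
       (auto intro!: derivative_eq_intros simp flip: has_real_derivative_iff_has_vector_derivative)
  then have E: "integral {0..t} (\<lambda>s. B * exp (K * s)) = B / K * exp (K * t) - B / K"
      "(\<lambda>s. B * exp (K * s)) integrable_on {0..t}"
    by (simp_all add: has_integral_iff)
  have "norm (integral {0..t} h) \<le> integral {0..t} (\<lambda>s. B * exp (K * s))"
    using assms E(2)
    by (intro integral_norm_bound_integral)
       (auto intro!: integrable_continuous_real intro: continuous_on_subset)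
  also have "\<dots> \<le> B / K * exp (K * t)"
    using E(1) assms by simp
  finally have "exp (- K * t) * norm (integral {0..t} h) \<le> exp (- K * t) * (B / K * exp (K * t))"
    by (intro mult_left_mono) auto
  also have "\<dots> = B / K"
    by (simp add: exp_minus)
  finally show ?thesis .
qed

text \<open>The weight \<open>exp (- K t)\<close> with \<open>K > 2 L\<close> makes the Picard operator a contraction on the whole
  half-line, so that no continuation argument is needed.\<close>

lemma lipschitz_ode_global_solution:
  fixes W :: "'a::banach \<Rightarrow> 'a"
  assumes lip: "L-lipschitz_on UNIV W"
  obtains z where "z 0 = z0"
    and "\<And>t. t \<ge> 0 \<Longrightarrow> (z has_vector_derivative W (z t)) (at t within {0..})"
proof -
  \<comment> \<open>This choice gives \<open>L / K \<le> 1 / 2\<close> and keeps \<open>K\<close>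
    positive even if \<open>L = 0\<close>.\<close>
  define K where "K = 2 * L + 1"
  have L: "L \<ge> 0" and K: "K > 0" "L / K \<le> 1 / 2"
    using lipschitz_on_nonneg[OF lip] by (auto simp: K_def field_simps)
  have W_lip: "norm (W x - W y) \<le> L * norm (x - y)" for x y
    using lipschitz_onD[OF lip, of x y] by (simp add: dist_norm)
  have W_cont: "continuous_on S W" for S
    using lipschitz_on_continuous_on[OF lip] continuous_on_subset by blast
  \<comment> \<open>The unknown is \<open>u t = exp (- K * t) *\<^sub>R z t\<close>, which is
    bounded although \<open>z\<close> may grow exponentially. So \<open>h u\<close> is the
    right-hand side evaluated along the \<open>z\<close> recovered from \<open>u\<close>.\<close>
  define h where "h u s = W (exp (K * s) *\<^sub>R apply_bcontfun u s)" for u :: "real \<Rightarrow>\<^sub>C 'a" and s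
  have h_cont: "continuous_on S (h u)" for u S
    unfolding h_def by (intro continuous_on_compose2[OF W_cont[of UNIV]] continuous_intros) auto
  define Q where "Q u t = z0 + integral {0..t} (h u)" for u t
  \<comment> \<open>Bounded continuous functions here live on all of the real line;
    \<open>max 0 t\<close> extends the Picard iterate to negative times by its value at
    \<open>0\<close>, which is \<open>z0\<close>.\<close>
  define P where "P u t = exp (- K * max 0 t) *\<^sub>R Q u (max 0 t)" for u and t :: real
  have Q_deriv: "(Q u has_vector_derivative h u t) (at t within {0..})" if "t \<ge> 0" for u t
    unfolding Q_def
    using has_vector_derivative_add[OF has_vector_derivative_const
        integral_has_vector_derivative_halfline[OF h_cont that], of z0 u] by simp
  have Q_cont: "continuous_on {0..} (Q u)" for u
    using Q_deriv by (intro continuous_on_vector_derivative) auto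
  have P_cont: "continuous_on UNIV (P u)" for u
    unfolding P_def by (intro continuous_intros continuous_on_compose2[OF Q_cont]) auto
  have P_bound: "norm (P u t) \<le> norm z0 + (norm (W 0) + L * norm u) / K" for u t
  proof -
    have hb: "norm (h u s) \<le> (norm (W 0) + L * norm u) * exp (K * s)" if "s \<ge> 0" for s
    proof -
      have "norm (h u s) \<le> norm (W 0) + L * norm (exp (K * s) *\<^sub>R apply_bcontfun u s)"
        using W_lip[of "exp (K * s) *\<^sub>R apply_bcontfun u s" 0] norm_triangle_sub[of "h u s" "W 0"]
        by (simp add: h_def)
      also have "\<dots> = norm (W 0) * 1 + L * norm (apply_bcontfun u s) * exp (K * s)"
        by simp
      also have "\<dots> \<le> norm (W 0) * exp (K * s) + L * norm u * exp (K * s)"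
        using L K that norm_bounded[of u s] by (intro add_mono mult_mono) auto
      finally show ?thesis
        by (simp add: algebra_simps)
    qed
    define \<tau> where "\<tau> = max 0 t"
    have "norm (P u t) \<le> exp (- K * \<tau>) * (norm z0 + norm (integral {0..\<tau>} (h u)))"
      unfolding P_def Q_def \<tau>_def by (simp add: norm_triangle_ineq)
    also have "\<dots> = exp (- K * \<tau>) * norm z0 + exp (- K * \<tau>) * norm (integral {0..\<tau>} (h u))"
      by (simp add: algebra_simps)
    also have "\<dots> \<le> 1 * norm z0 + (norm (W 0) + L * norm u) / K"
      using L K hb h_cont
      by (intro add_mono mult_right_mono norm_integral_exp_le) (auto simp: \<tau>_def)
    finally show ?thesis
      by simp
  qed
  define T where "T u = Bcontfun (P u)" for u
  have T_apply: "apply_bcontfun (T u) = P u" for u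
    unfolding T_def by (rule Bcontfun_inverse, rule bcontfun_normI[OF P_cont P_bound])
  have T_lip: "dist (T u) (T v) \<le> 1 / 2 * dist u v" for u v
  proof (rule dist_bound)
    fix t :: real
    define \<tau> where "\<tau> = max 0 t"
    have hb: "norm (h u s - h v s) \<le> (L * dist u v) * exp (K * s)" for s
    proof -
      have "norm (h u s - h v s) \<le> L * norm (exp (K * s) *\<^sub>R (apply_bcontfun u s - apply_bcontfun v s))"
        unfolding h_def by (metis W_lip scaleR_diff_right)
      also have "\<dots> = L * dist (apply_bcontfun u s) (apply_bcontfun v s) * exp (K * s)"
        by (simp add: dist_norm)
      also have "\<dots> \<le> L * dist u v * exp (K * s)"
        using L dist_bounded[of u s v] by (intro mult_right_mono mult_left_mono) auto
      finally show ?thesis .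
    qed
    have "dist (P u t) (P v t) = exp (- K * \<tau>) * norm (integral {0..\<tau>} (\<lambda>s. h u s - h v s))"
      unfolding dist_norm P_def Q_def \<tau>_def
      by (subst integral_diff)
         (auto intro!: integrable_continuous_real h_cont simp flip: scaleR_diff_right)
    also have "\<dots> \<le> L * dist u v / K"
      using L K hb by (intro norm_integral_exp_le continuous_intros h_cont) (auto simp: \<tau>_def)
    also have "\<dots> \<le> 1 / 2 * dist u v"
      using mult_right_mono[OF K(2), of "dist u v"] by simp
    finally show "dist (apply_bcontfun (T u) t) (apply_bcontfun (T v) t) \<le> 1 / 2 * dist u v"
      by (simp add: T_apply)
  qed
  \<comment> \<open>Undoing the weight in the fixed-point equation shows that \<open>Q u\<close>
    satisfies the integral equation, so \<open>Q u\<close> is the solution.\<close>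
  obtain u where u: "T u = u"
    using banach_fix_type[of "1/2" T] T_lip by auto
  have u_eq: "exp (K * t) *\<^sub>R apply_bcontfun u t = Q u t" if "t \<ge> 0" for t
  proof -
    have "apply_bcontfun u t = exp (- K * t) *\<^sub>R Q u t"
      using T_apply[of u] that by (simp add: u P_def)
    then show ?thesis
      by (simp add: exp_minus)
  qed
  show thesis
  proof (rule that[of "Q u"])
    show "Q u 0 = z0"
      by (simp add: Q_def)
    show "(Q u has_vector_derivative W (Q u t)) (at t within {0..})" if "t \<ge> 0" for t
      using Q_deriv[OF that, of u] u_eq[OF that] by (simp add: h_def)
  qed
qed

text \<open>While \<open>z\<close> stays in the ball, \<open>exp (2 * c * t)\<close> times the
  squared distance to \<open>p\<close> is nonincreasing: its derivative has the sign of
  \<open>c * (norm (z t - p))\<^sup>2 + (z t - p) \<bullet> V (z t)\<close>. A first exit time is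
  then impossible, because the distance there would still be below \<open>\<delta>\<close>.\<close>

lemma lyapunov_exponential_decay:
  fixes z :: "real \<Rightarrow> 'a::real_inner"
  assumes deriv: "\<And>t. t \<ge> 0 \<Longrightarrow> (z has_vector_derivative V (z t)) (at t within {0..})"
    and inS: "\<And>t. t \<ge> 0 \<Longrightarrow> z t \<in> S"
    and neg: "\<And>x. x \<in> S \<inter> ball p r \<Longrightarrow> (x - p) \<bullet> V x \<le> - c * (norm (x - p))\<^sup>2"
    and "c \<ge> 0" "\<delta> \<le> r" "z 0 \<in> ball p \<delta>" "t \<ge> 0"
  shows "z t \<in> ball p \<delta>" and "norm (z t - p) \<le> exp (- c * t) * norm (z 0 - p)"
proof -
  define E where "E t = exp (2 * c * t) * ((z t - p) \<bullet> (z t - p))" for t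
  have cont: "continuous_on {0..} z"
    using deriv by (intro continuous_on_vector_derivative) auto
  \<comment> \<open>The ball is assumed only at times strictly between \<open>0\<close> and
    \<open>t\<close>, so that the estimate applies at the first exit time itself.\<close>
  have step: "norm (z t - p) \<le> exp (- c * t) * norm (z 0 - p)"
    if "t \<ge> 0" and ball: "\<And>s. 0 < s \<Longrightarrow> s < t \<Longrightarrow> z s \<in> ball p \<delta>" for t
  proof -
    have "E t \<le> E 0"
    proof (rule DERIV_nonpos_imp_decreasing_open[OF \<open>t \<ge> 0\<close>])
      fix s assume s: "0 < s" "s < t"
      have "at s within {0..} = at s"
        using s by (intro at_within_interior) (auto simp: interior_Ici[of "-1"])
      then have z': "(z has_derivative (\<lambda>h. h *\<^sub>R V (z s))) (at s)"
        using deriv[of s] s by (simp add: has_vector_derivative_def)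
      have "(E has_derivative (\<lambda>h. h * (2 * exp (2 * c * s) *
                 (c * ((z s - p) \<bullet> (z s - p)) + (z s - p) \<bullet> V (z s))))) (at s)"
        unfolding E_def
        by (rule derivative_eq_intros z' refl | simp)+ (auto simp: algebra_simps inner_commute fun_eq_iff)
      then have "DERIV E s :> 2 * exp (2 * c * s) *
          (c * ((z s - p) \<bullet> (z s - p)) + (z s - p) \<bullet> V (z s))"
        by (simp add: has_field_derivative_def mult_commute_abs)
      moreover have "c * ((z s - p) \<bullet> (z s - p)) + (z s - p) \<bullet> V (z s) \<le> 0"
        using neg[of "z s"] inS[of s] ball[OF s] s \<open>\<delta> \<le> r\<close> by (auto simp: power2_norm_eq_inner)
      ultimately show "\<exists>y. DERIV E s :> y \<and> y \<le> 0"
        by - (rule exI, rule conjI, assumption, simp add: mult_nonneg_nonpos)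
    next
      show "continuous_on {0..t} E"
        unfolding E_def by (intro continuous_intros continuous_on_subset[OF cont]) auto
    qed
    then have "(exp (c * t) * norm (z t - p))\<^sup>2 \<le> (norm (z 0 - p))\<^sup>2"
      by (simp add: E_def power_mult_distrib power2_norm_eq_inner mult.assoc flip: exp_double)
    then have "exp (c * t) * norm (z t - p) \<le> norm (z 0 - p)"
      by (rule power2_le_imp_le) simp
    then show ?thesis
      by (simp add: exp_minus field_simps)
  qed
  have ball: "z t \<in> ball p \<delta>" if "t \<ge> 0" for t
  proof (rule ccontr)
    assume out: "z t \<notin> ball p \<delta>"
    \<comment> \<open>\<open>A\<close> collects the times up to \<open>t\<close> spent outside the
      open ball. It is closed, so the first exit time \<open>Inf A\<close> belongs to it.\<close>
    define A where "A = {0..t} \<inter> z -` (- ball p \<delta>)"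
    have "closed A"
      unfolding A_def
      by (intro continuous_closed_preimage continuous_on_subset[OF cont]) auto
    moreover have A: "t \<in> A" "bdd_below A"
      using out that by (auto simp: A_def intro: bdd_belowI[of _ 0])
    ultimately have s: "Inf A \<in> A"
      using closed_contains_Inf by blast
    have "norm (z (Inf A) - p) \<le> exp (- c * Inf A) * norm (z 0 - p)"
    proof (rule step)
      show "Inf A \<ge> 0"
        using s by (auto simp: A_def)
      fix s' assume s': "0 < s'" "s' < Inf A"
      then have "s' \<notin> A"
        using cInf_lower[OF _ A(2)] by force
      then show "z s' \<in> ball p \<delta>"
        using s' s by (auto simp: A_def)
    qed
    also have "\<dots> \<le> 1 * norm (z 0 - p)"
      using s \<open>c \<ge> 0\<close> by (intro mult_right_mono) (auto simp: A_def)
    also have "\<dots> < \<delta>"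
      using \<open>z 0 \<in> ball p \<delta>\<close> by (simp add: dist_norm norm_minus_commute)
    finally show False
      using s by (auto simp: A_def dist_norm norm_minus_commute)
  qed
  show "z t \<in> ball p \<delta>"
    using ball \<open>t \<ge> 0\<close> by blast
  show "norm (z t - p) \<le> exp (- c * t) * norm (z 0 - p)"
    using step ball \<open>t \<ge> 0\<close> by auto
qed

text \<open>A negative value would be preceded by a zero \<open>s\<close>. From \<open>s\<close> on,
  the Gronwall quantity \<open>exp (- 2 * L * t) * (u t)\<^sup>2\<close> cannot increase, so
  \<open>u\<close> would remain zero. This keeps solutions from crossing the boundary of the
  half-plane.\<close>

lemma nonneg_if_derivative_dominated:
  fixes u :: "real \<Rightarrow> real"
  assumes deriv: "\<And>t. t \<ge> 0 \<Longrightarrow> (u has_vector_derivative u' t) (at t within {0..})"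
    and bound: "\<And>t. t \<ge> 0 \<Longrightarrow> \<bar>u' t\<bar> \<le> L * \<bar>u t\<bar>"
    and "u 0 \<ge> 0" "t \<ge> 0"
  shows "u t \<ge> 0"
proof (rule ccontr)
  assume neg: "\<not> u t \<ge> 0"
  have cont: "continuous_on {0..} u"
    using deriv by (intro continuous_on_vector_derivative) auto
  obtain s where s: "0 \<le> s" "s \<le> t" "u s = 0"
    using IVT2'[of u t 0 0] neg \<open>u 0 \<ge> 0\<close> \<open>t \<ge> 0\<close> continuous_on_subset[OF cont] by force
  define E where "E t = exp (- 2 * L * t) * (u t)\<^sup>2" for t
  have "E t \<le> E s"
  proof (rule DERIV_nonpos_imp_decreasing_open[OF \<open>s \<le> t\<close>])
    fix x assume x: "s < x" "x < t"
    have "at x within {0..} = at x"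
      using x s by (intro at_within_interior) (auto simp: interior_Ici[of "-1"])
    then have u': "(u has_real_derivative u' x) (at x)"
      using deriv[of x] x s by (simp add: has_real_derivative_iff_has_vector_derivative)
    have "DERIV E x :> 2 * exp (- 2 * L * x) * (u x * u' x - L * (u x)\<^sup>2)"
      unfolding E_def
      by (rule derivative_eq_intros u' refl | simp)+ (auto simp: algebra_simps power2_eq_square)
    moreover have "u x * u' x \<le> L * (u x)\<^sup>2"
    proof -
      have "u x * u' x \<le> \<bar>u x\<bar> * \<bar>u' x\<bar>"
        by (metis abs_ge_self abs_mult)
      also have "\<dots> \<le> \<bar>u x\<bar> * (L * \<bar>u x\<bar>)"
        using bound[of x] x s by (intro mult_left_mono) auto
      finally show ?thesis
        by (simp add: power2_eq_square algebra_simps abs_mult_self_eq)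
    qed
    ultimately show "\<exists>y. DERIV E x :> y \<and> y \<le> 0"
      by - (rule exI, rule conjI, assumption, simp add: mult_nonneg_nonpos)
  next
    show "continuous_on {s..t} E"
      unfolding E_def using s by (intro continuous_intros continuous_on_subset[OF cont]) auto
  qed
  then show False
    using s neg by (auto simp: E_def mult_le_0_iff)
qed

text \<open>\<open>H\<close> extends \<open>V\<close> beyond the boundary, so the equation can first
  be solved in the plane and its solution then shown to stay in the half-plane. As the derivative at
  \<open>p\<close> is a negative multiple of the identity, the squared distance to \<open>p\<close>
  decreases along solutions.\<close>

lemma attracting_half_planeI:
  fixes V H :: "real^2 \<Rightarrow> real^2"
  assumes "r > 0" and lip: "L-lipschitz_on (cball p r) H"
    and deriv: "(H has_derivative (\<lambda>h. - lam *\<^sub>R h)) (at p)" and "lam > 0"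
    and "H p = 0" "p $ 2 = 0"
    and boundary: "\<And>z. z $ 2 = 0 \<Longrightarrow> H z $ 2 = 0"
    and V_eq: "\<And>z. z \<in> half_plane \<Longrightarrow> V z = H z"
  shows "attracting V half_plane p"
proof -
  \<comment> \<open>The remainder may consume half of the rate \<open>lam\<close>; the other half is
    left for the decay.\<close>
  obtain d where "d > 0" and d: "\<And>y. norm (y - p) < d \<Longrightarrow>
      norm (H y + lam *\<^sub>R (y - p)) \<le> lam / 2 * norm (y - p)"
    using deriv \<open>lam > 0\<close> \<open>H p = 0\<close> unfolding has_derivative_at_alt
    by (auto dest!: spec[of _ "lam / 2"])
  define \<rho> where "\<rho> = min d r"
  have \<rho>: "\<rho> > 0" "\<rho> \<le> d" "\<rho> \<le> r"
    using \<open>d > 0\<close> \<open>r > 0\<close> by (auto simp: \<rho>_def)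
  have H_neg: "(x - p) \<bullet> H x \<le> - (lam / 2) * (norm (x - p))\<^sup>2" if "x \<in> ball p \<rho>" for x
  proof -
    have "(x - p) \<bullet> (H x + lam *\<^sub>R (x - p)) \<le> norm (x - p) * norm (H x + lam *\<^sub>R (x - p))"
      by (rule norm_cauchy_schwarz)
    also have "\<dots> \<le> norm (x - p) * (lam / 2 * norm (x - p))"
      using that d[of x] \<rho> by (intro mult_left_mono) (auto simp: dist_norm norm_minus_commute)
    finally show ?thesis
      by (simp add: inner_add_right power2_norm_eq_inner[symmetric] power2_eq_square)
  qed
  have V_neg: "(x - p) \<bullet> V x \<le> - (lam / 2) * (norm (x - p))\<^sup>2" if "x \<in> half_plane \<inter> ball p \<rho>" for x
    using H_neg[of x] V_eq that by auto
  have trap: "z t \<in> ball p \<delta>" "norm (z t - p) \<le> exp (- (lam / 2) * t) * norm (z 0 - p)"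
    if "forward_solution V half_plane z0 z" "z0 \<in> ball p \<delta>" "\<delta> \<le> \<rho>" "t \<ge> 0" for z z0 t \<delta>
    using that lyapunov_exponential_decay[of z V half_plane p \<rho> "lam / 2" \<delta> t] V_neg \<open>lam > 0\<close>
    by (auto simp: forward_solution_def)
  have "p \<in> half_plane" "V p = 0"
    using \<open>p $ 2 = 0\<close> \<open>H p = 0\<close> V_eq by (auto simp: half_plane_def)
  moreover have "\<exists>z. forward_solution V half_plane z0 z" if z0: "z0 \<in> half_plane \<inter> ball p \<rho>" for z0
  proof -
    \<comment> \<open>Composing with the projection onto the ball gives a globally Lipschitz field; its solution
      stays in the ball, where the two fields agree.\<close>
    define C where "C = cball p r"
    have C: "convex C" "closed C" "C \<noteq> {}"
      using \<open>r > 0\<close> by (auto simp: C_def)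
    define W where "W x = H (closest_point C x)" for x
    have "L-lipschitz_on UNIV W"
    proof (rule lipschitz_onI)
      show "dist (W x) (W y) \<le> L * dist x y" for x y
      proof -
        have "dist (W x) (W y) \<le> L * dist (closest_point C x) (closest_point C y)"
          unfolding W_def using closest_point_in_set[OF C(2,3)]
          by (intro lipschitz_onD[OF lip]) (simp_all add: C_def del: mem_cball)
        also have "\<dots> \<le> L * dist x y"
          using closest_point_lipschitz[OF C] lipschitz_on_nonneg[OF lip] by (intro mult_left_mono) auto
        finally show ?thesis .
      qed
    qed (rule lipschitz_on_nonneg[OF lip])
    then obtain z where z: "z 0 = z0"
        "\<And>t. t \<ge> 0 \<Longrightarrow> (z has_vector_derivative W (z t)) (at t within {0..})"
      using lipschitz_ode_global_solution by blast
    have W_eq: "W x = H x" if "x \<in> ball p \<rho>" for x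
      using that \<rho> by (simp add: W_def C_def closest_point_self)
    \<comment> \<open>Here \<open>S = UNIV\<close>, since invariance of the half-plane is not yet
      known; \<open>H_neg\<close> holds on the full ball, on both sides of the boundary.\<close>
    have ball: "z t \<in> ball p \<rho>" if "t \<ge> 0" for t
    proof (rule lyapunov_exponential_decay(1)[where z = z and V = W and S = UNIV and c = "lam / 2" and r = \<rho>])
      show "(x - p) \<bullet> W x \<le> - (lam / 2) * (norm (x - p))\<^sup>2" if "x \<in> UNIV \<inter> ball p \<rho>" for x
        using that H_neg[of x] W_eq[of x] by simp
    qed (use that z z0 \<open>lam > 0\<close> in auto)
    have half: "z t \<in> half_plane" if "t \<ge> 0" for t
    proof -
      have "z t $ 2 \<ge> 0"
      proof (rule nonneg_if_derivative_dominated[where u = "\<lambda>t. z t $ 2" and u' = "\<lambda>t. W (z t) $ 2" and L = L])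
        fix s :: real assume s: "s \<ge> 0"
        show "((\<lambda>t. z t $ 2) has_vector_derivative W (z s) $ 2) (at s within {0..})"
          by (rule bounded_linear.has_vector_derivative[OF bounded_linear_vec_nth z(2)[OF s]])
        \<comment> \<open>\<open>y\<close> is the projection of \<open>z s\<close> onto the boundary
          line, where the second component of \<open>H\<close> vanishes. Projecting does not
          increase the distance to \<open>p\<close>, because \<open>p\<close> lies on that line.
          Hence the Lipschitz bound between \<open>z s\<close> and \<open>y\<close> controls the
          second component of the field by that of \<open>z s\<close>.\<close>
        define y :: "real^2" where "y = vector [z s $ 1, 0]"
        have "dist p y \<le> dist p (z s)"
          unfolding dist_norm norm_vec_def L2_set_def
          using \<open>p $ 2 = 0\<close> by (simp add: y_def sum_2 vector_2)
        then have mem: "y \<in> cball p r" "z s \<in> cball p r"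
          using ball[OF s] \<rho> by auto
        have "\<bar>W (z s) $ 2\<bar> = \<bar>(H (z s) - H y) $ 2\<bar>"
          using boundary[of y] W_eq[OF ball[OF s]] by (simp add: y_def vector_2)
        also have "\<dots> \<le> dist (H (z s)) (H y)"
          unfolding dist_norm by (rule component_le_norm_cart)
        also have "\<dots> \<le> L * dist (z s) y"
          using mem by (intro lipschitz_onD[OF lip])
        also have "dist (z s) y = \<bar>z s $ 2\<bar>"
          by (simp add: dist_norm norm_vec_def L2_set_def y_def sum_2 vector_2)
        finally show "\<bar>W (z s) $ 2\<bar> \<le> L * \<bar>z s $ 2\<bar>" .
      qed (use z z0 that in \<open>auto simp: half_plane_def\<close>)
      then show ?thesis
        by (simp add: half_plane_def)
    qed
    have "forward_solution V half_plane z0 z"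
      using z half ball W_eq V_eq by (auto simp: forward_solution_def)
    then show ?thesis
      by blast
  qed
  moreover have "\<exists>\<delta>>0. \<forall>z0\<in>half_plane \<inter> ball p \<delta>. \<forall>z. forward_solution V half_plane z0 z \<longrightarrow>
      (\<forall>t\<ge>0. z t \<in> ball p \<epsilon>)" if "\<epsilon> > 0" for \<epsilon>
  proof (intro exI[of _ "min \<epsilon> \<rho>"] conjI ballI allI impI)
    show "min \<epsilon> \<rho> > 0"
      using that \<rho> by auto
    fix z0 z t
    assume "z0 \<in> half_plane \<inter> ball p (min \<epsilon> \<rho>)" "forward_solution V half_plane z0 z" "0 \<le> (t::real)"
    then show "z t \<in> ball p \<epsilon>"
      using trap(1)[of z0 z "min \<epsilon> \<rho>" t] by auto
  qed
  moreover have "(z \<longlongrightarrow> p) at_top"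
    if "z0 \<in> half_plane \<inter> ball p \<rho>" "forward_solution V half_plane z0 z" for z0 z
  proof -
    have "((\<lambda>t. exp (- (lam / 2) * t)) \<longlongrightarrow> 0) at_top"
      using \<open>lam > 0\<close> by real_asymp
    then have "((\<lambda>t. exp (- (lam / 2) * t) * norm (z 0 - p)) \<longlongrightarrow> 0) at_top"
      by (rule tendsto_mult_left_zero)
    moreover have "\<forall>\<^sub>F t in at_top. norm (z t - p) \<le> exp (- (lam / 2) * t) * norm (z 0 - p)"
      using eventually_ge_at_top[of 0] by eventually_elim (use that trap(2) in auto)
    ultimately have "((\<lambda>t. z t - p) \<longlongrightarrow> 0) at_top"
      by (rule Lim_null_comparison[rotated])
    then show ?thesis
      by (simp add: LIM_zero_iff)
  qed
  ultimately show ?thesis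
    unfolding attracting_def using \<rho>(1) by blast
qed

section \<open>Gaussian means\<close>

text \<open>The limit condition of \<open>Ckp\<close> becomes a bound at every point with a natural
  exponent, a form that survives affine substitution and multiplication by powers of
  \<open>x\<close>.\<close>

definition poly_bounded :: "(real \<Rightarrow> real) \<Rightarrow> bool" where
  "poly_bounded g \<longleftrightarrow> (\<exists>C\<ge>0. \<exists>n. \<forall>x. \<bar>g x\<bar> \<le> C * (1 + \<bar>x\<bar>) ^ n)"

lemma poly_boundedI:
  assumes cont: "continuous_on UNIV g"
    and lim: "((\<lambda>x. g x / \<bar>x\<bar> powr m) \<longlongrightarrow> 0) at_infinity"
  shows "poly_bounded g"
proof -
  have "\<forall>\<^sub>F x in at_infinity. \<bar>g x / \<bar>x\<bar> powr m\<bar> < 1"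
    using tendstoD[OF lim zero_less_one] by simp
  then obtain b where b: "\<And>x. norm x \<ge> b \<Longrightarrow> \<bar>g x / \<bar>x\<bar> powr m\<bar> < 1"
    unfolding eventually_at_infinity by blast
  \<comment> \<open>Beyond \<open>c \<ge> 1\<close> raising an exponent only enlarges the power, so
    \<open>m\<close> can be rounded up to the natural number \<open>n\<close>.\<close>
  define c where "c = max b 1"
  define n where "n = nat \<lceil>m\<rceil>"
  have "bounded (g ` cball 0 c)"
    by (intro compact_imp_bounded compact_continuous_image continuous_on_subset[OF cont]) auto
  then obtain B where "\<forall>x\<in>cball 0 c. \<bar>g x\<bar> \<le> B"
    unfolding bounded_iff by auto
  then have B: "\<bar>g x\<bar> \<le> B" if "\<bar>x\<bar> \<le> c" for x
    using that by simp
  have B0: "B \<ge> 0"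
    using order_trans[OF abs_ge_zero B[of 0]] by (simp add: c_def)
  have "\<bar>g x\<bar> \<le> (B + 1) * (1 + \<bar>x\<bar>) ^ n" for x
  proof (cases "\<bar>x\<bar> \<le> c")
    case True
    have "\<bar>g x\<bar> \<le> (B + 1) * 1"
      using B[OF True] by simp
    also have "\<dots> \<le> (B + 1) * (1 + \<bar>x\<bar>) ^ n"
      using B0 by (intro mult_left_mono one_le_power) auto
    finally show ?thesis .
  next
    case False
    then have x: "\<bar>x\<bar> \<ge> 1" "\<bar>x\<bar> \<ge> b"
      by (auto simp: c_def)
    have "\<bar>g x\<bar> \<le> \<bar>x\<bar> powr m"
      using b[of x] x by (simp add: abs_divide divide_less_eq split: if_splits)
    also have "\<dots> \<le> \<bar>x\<bar> powr real n"
      using x by (intro powr_mono) (simp_all add: n_def real_nat_ceiling_ge)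
    also have "\<dots> = 1 * \<bar>x\<bar> ^ n"
      using x by (simp add: powr_realpow)
    also have "\<dots> \<le> (B + 1) * (1 + \<bar>x\<bar>) ^ n"
      using B0 by (intro mult_mono power_mono) auto
    finally show ?thesis .
  qed
  then show ?thesis
    unfolding poly_bounded_def using B0 by (intro exI[of _ "B + 1"]) auto
qed

text \<open>The parameters sit in the argument of \<open>g\<close> rather than in the density, so
  nothing degenerates as \<open>z $ 2\<close> tends to \<open>0\<close>. The index \<open>k\<close>
  makes the family closed under differentiation: each derivative in \<open>z $ 2\<close> produces
  one more factor \<open>x\<close>.\<close>

definition gauss_mean :: "nat \<Rightarrow> (real \<Rightarrow> real) \<Rightarrow> real^2 \<Rightarrow> real" where
  "gauss_mean k g z = (\<integral>x. std_normal_density x * x ^ k * g (z $ 1 + z $ 2 * x) \<partial>lborel)"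

text \<open>The dominating function for the integrals below, in the form that
  \<open>weighted_bound\<close> delivers.\<close>

lemma integrable_std_normal_poly: "integrable lborel (\<lambda>x. c * (std_normal_density x * (1 + \<bar>x\<bar>) ^ n))"
proof -
  have eq: "std_normal_density x * (1 + \<bar>x\<bar>) ^ n =
      (\<Sum>k\<le>n. real (n choose k) * (std_normal_density x * \<bar>x\<bar> ^ k))" for x
  proof -
    have "(1 + \<bar>x\<bar>) ^ n = (\<Sum>k\<le>n. real (n choose k) * \<bar>x\<bar> ^ k)"
      using binomial_ring[of "\<bar>x\<bar>" 1 n] by (simp add: add.commute)
    then show ?thesis
      by (simp only: sum_distrib_left mult.left_commute)
  qed
  show ?thesis
    unfolding eq
    by (intro integrable_mult_right Bochner_Integration.integrable_sum integrable_std_normal_moment_abs)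
qed

lemma affine_growth:
  fixes x :: real
  assumes "\<bar>a\<bar> \<le> M" "\<bar>b\<bar> \<le> M"
  shows "1 + \<bar>a + b * x\<bar> \<le> (1 + M) * (1 + \<bar>x\<bar>)"
proof -
  have "\<bar>a + b * x\<bar> \<le> \<bar>a\<bar> + \<bar>b\<bar> * \<bar>x\<bar>"
    by (metis abs_mult abs_triangle_ineq)
  also have "\<dots> \<le> M + M * \<bar>x\<bar>"
    using assms by (intro add_mono mult_right_mono) auto
  finally show ?thesis
    using assms by (simp add: algebra_simps)
qed

text \<open>\<open>C\<close> and \<open>n\<close> are uniform over bounded parameters, so a single
  integrable function dominates along a whole convergent sequence.\<close>

lemma poly_bounded_affine:
  assumes "poly_bounded g"
  obtains C n where "C \<ge> 0"
    and "\<And>a b x. \<bar>a\<bar> \<le> M \<Longrightarrow> \<bar>b\<bar> \<le> M \<Longrightarrow> \<bar>g (a + b * x)\<bar> \<le> C * (1 + \<bar>x\<bar>) ^ n"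
proof -
  obtain C n where C: "C \<ge> 0" "\<And>x. \<bar>g x\<bar> \<le> C * (1 + \<bar>x\<bar>) ^ n"
    using assms by (auto simp: poly_bounded_def)
  \<comment> \<open>The absolute value in the constant keeps it nonnegative also for negative
    \<open>M\<close>, when the estimate itself is vacuous.\<close>
  show thesis
  proof (rule that[of "C * \<bar>1 + M\<bar> ^ n" n])
    fix a b x assume ab: "\<bar>a\<bar> \<le> M" "\<bar>b\<bar> \<le> (M::real)"
    have "\<bar>g (a + b * x)\<bar> \<le> C * (1 + \<bar>a + b * x\<bar>) ^ n"
      by (rule C)
    also have "\<dots> \<le> C * ((1 + M) * (1 + \<bar>x\<bar>)) ^ n"
      using C ab affine_growth[of a M b x] by (intro mult_left_mono power_mono) auto
    finally show "\<bar>g (a + b * x)\<bar> \<le> C * \<bar>1 + M\<bar> ^ n * (1 + \<bar>x\<bar>) ^ n"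
      using ab by (simp add: power_mult_distrib mult.assoc)
  qed (use C in auto)
qed

lemma weighted_bound:
  fixes x :: real
  assumes "\<bar>y\<bar> \<le> C * (1 + \<bar>x\<bar>) ^ n"
  shows "\<bar>std_normal_density x * x ^ k * y\<bar> \<le> C * (std_normal_density x * (1 + \<bar>x\<bar>) ^ (n + k))"
proof -
  have "\<bar>std_normal_density x * x ^ k * y\<bar> = std_normal_density x * (\<bar>x\<bar> ^ k * \<bar>y\<bar>)"
    by (simp add: abs_mult power_abs)
  also have "\<dots> \<le> std_normal_density x * ((1 + \<bar>x\<bar>) ^ k * (C * (1 + \<bar>x\<bar>) ^ n))"
    using assms by (intro mult_left_mono mult_mono power_mono) auto
  finally show ?thesis
    by (simp add: power_add ac_simps)
qed

section \<open>Integrability, continuity and differentiability of Gaussian means\<close>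

lemma gauss_mean_integrable:
  assumes g: "continuous_on UNIV g" "poly_bounded g"
  shows "integrable lborel (\<lambda>x. std_normal_density x * x ^ k * g (a + b * x))"
proof -
  obtain C n where "\<And>x. \<bar>g (a + b * x)\<bar> \<le> C * (1 + \<bar>x\<bar>) ^ n"
    using poly_bounded_affine[OF g(2), of "max \<bar>a\<bar> \<bar>b\<bar>"] by (metis max.cobounded1 max.cobounded2)
  note bound = weighted_bound[OF this]
  have [measurable]: "g \<in> borel_measurable borel"
    using g(1) by (rule borel_measurable_continuous_onI)
  show ?thesis
    by (rule Bochner_Integration.integrable_bound[OF integrable_std_normal_poly[of C "n + k"]])
       (use order_trans[OF bound abs_ge_self] in auto)
qed

lemma gauss_mean_isCont:
  assumes g: "continuous_on UNIV g" "poly_bounded g"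
  shows "isCont (gauss_mean k g) z"
  unfolding isCont_def tendsto_at_iff_sequentially comp_def
proof (intro allI impI)
  fix X :: "nat \<Rightarrow> real^2" assume X: "X \<longlonglongrightarrow> z"
  obtain M where M: "\<And>i. norm (X i) \<le> M"
    using convergent_imp_bounded[OF X] unfolding bounded_iff by blast
  obtain C n where C: "\<And>a b x. \<bar>a\<bar> \<le> M \<Longrightarrow> \<bar>b\<bar> \<le> M \<Longrightarrow> \<bar>g (a + b * x)\<bar> \<le> C * (1 + \<bar>x\<bar>) ^ n"
    using poly_bounded_affine[OF g(2), of M] by metis
  have [measurable]: "g \<in> borel_measurable borel"
    using g(1) by (rule borel_measurable_continuous_onI)
  have XM: "\<bar>X i $ j\<bar> \<le> M" for i j
    using M[of i] component_le_norm_cart[of "X i" j] by linarith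
  show "(\<lambda>i. gauss_mean k g (X i)) \<longlonglongrightarrow> gauss_mean k g z"
    unfolding gauss_mean_def
  proof (rule integral_dominated_convergence)
    show "integrable lborel (\<lambda>x. C * (std_normal_density x * (1 + \<bar>x\<bar>) ^ (n + k)))"
      by (rule integrable_std_normal_poly)
    show "AE x in lborel. norm (std_normal_density x * x ^ k * g (X i $ 1 + X i $ 2 * x))
        \<le> C * (std_normal_density x * (1 + \<bar>x\<bar>) ^ (n + k))" for i
      using weighted_bound[OF C[OF XM XM]] by auto
    have "(\<lambda>i. std_normal_density x * x ^ k * g (X i $ 1 + X i $ 2 * x)) \<longlonglongrightarrow>
        std_normal_density x * x ^ k * g (z $ 1 + z $ 2 * x)" for x
      by (intro tendsto_intros X isCont_tendsto_compose[of _ g] tendsto_vec_nth)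
         (use g(1) in \<open>simp add: continuous_on_eq_continuous_at\<close>)
    then show "AE x in lborel. (\<lambda>i. std_normal_density x * x ^ k * g (X i $ 1 + X i $ 2 * x)) \<longlonglongrightarrow>
        std_normal_density x * x ^ k * g (z $ 1 + z $ 2 * x)"
      by auto
  qed measurable
qed

text \<open>Differentiation under the integral: the normalized first-order remainder
  \<open>R h x\<close> tends to \<open>0\<close> for each \<open>x\<close> and is dominated by means
  of the mean value inequality. Sequences are used so that dominated convergence applies.\<close>

lemma gauss_mean_has_derivative:
  assumes g: "continuous_on UNIV g" "poly_bounded g"
    and g': "continuous_on UNIV g'" "poly_bounded g'"
    and deriv: "\<And>x. (g has_real_derivative g' x) (at x)"
  shows "(gauss_mean k g has_derivative
      (\<lambda>h. h $ 1 * gauss_mean k g' z + h $ 2 * gauss_mean (Suc k) g' z)) (at z)"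
  unfolding has_derivative_at
proof
  let ?D = "\<lambda>h. h $ 1 * gauss_mean k g' z + h $ 2 * gauss_mean (Suc k) g' z"
  show "bounded_linear ?D"
    by (intro bounded_linear_add bounded_linear_mult_const bounded_linear_vec_nth)
  define R where "R h x = (g (z $ 1 + z $ 2 * x + (h $ 1 + h $ 2 * x)) - g (z $ 1 + z $ 2 * x)
      - g' (z $ 1 + z $ 2 * x) * (h $ 1 + h $ 2 * x)) / norm h" for h :: "real^2" and x
  have [measurable]: "g \<in> borel_measurable borel" "g' \<in> borel_measurable borel"
    using g(1) g'(1) by (auto intro: borel_measurable_continuous_onI)
  have R_int: "(gauss_mean k g (z + h) - gauss_mean k g z - ?D h) / norm h =
      (\<integral>x. std_normal_density x * x ^ k * R h x \<partial>lborel)" for h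
  proof -
    note I = gauss_mean_integrable[OF g, of k] gauss_mean_integrable[OF g', of k]
      gauss_mean_integrable[OF g', of "Suc k"]
    have "(\<integral>x. std_normal_density x * x ^ k * R h x \<partial>lborel) =
      (\<integral>x. (std_normal_density x * x ^ k * g ((z + h) $ 1 + (z + h) $ 2 * x)
        - std_normal_density x * x ^ k * g (z $ 1 + z $ 2 * x)
        - (h $ 1 * (std_normal_density x * x ^ k * g' (z $ 1 + z $ 2 * x))
         + h $ 2 * (std_normal_density x * x ^ Suc k * g' (z $ 1 + z $ 2 * x)))) / norm h \<partial>lborel)"
      by (intro Bochner_Integration.integral_cong refl) (simp add: R_def field_simps)
    also have "\<dots> = (gauss_mean k g (z + h) - gauss_mean k g z - ?D h) / norm h"
      unfolding gauss_mean_def using I by simp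
    finally show ?thesis ..
  qed
  show "(\<lambda>h. norm (gauss_mean k g (z + h) - gauss_mean k g z - ?D h) / norm h) \<midarrow>0\<rightarrow> 0"
    unfolding tendsto_at_iff_sequentially comp_def
  proof (intro allI impI)
    fix X :: "nat \<Rightarrow> real^2" assume X0: "\<forall>i. X i \<in> UNIV - {0}" and X: "X \<longlonglongrightarrow> 0"
    obtain M0 where M0: "\<And>i. norm (X i) \<le> M0"
      using convergent_imp_bounded[OF X] unfolding bounded_iff by blast
    \<comment> \<open>\<open>M\<close> bounds the components of \<open>z + t *\<^sub>R X i\<close>
      for all \<open>t\<close> in \<open>{0..1}\<close>, so the growth bound on \<open>g'\<close>
      holds along the whole segment from \<open>z\<close> to \<open>z + X i\<close>.\<close>
    define M where "M = norm z + M0"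
    obtain C n where C0: "C \<ge> 0" and
        C: "\<And>a b x. \<bar>a\<bar> \<le> M \<Longrightarrow> \<bar>b\<bar> \<le> M \<Longrightarrow> \<bar>g' (a + b * x)\<bar> \<le> C * (1 + \<bar>x\<bar>) ^ n"
      using poly_bounded_affine[OF g'(2), of M] by metis
    \<comment> \<open>The increment of \<open>g\<close> and its linear part contribute
      \<open>C\<close> each, hence \<open>2 * C\<close>. The argument moves by at most
      \<open>norm h * (1 + \<bar>x\<bar>)\<close>: the norm cancels the division in
      \<open>R\<close>, and the other factor raises the exponent to \<open>Suc n\<close>.\<close>
    have R_bound: "\<bar>R (X i) x\<bar> \<le> 2 * C * (1 + \<bar>x\<bar>) ^ Suc n" for i x
    proof -
      define h where "h = X i"
      have h: "norm h > 0"
        using X0 by (auto simp: h_def)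
      define y where "y = z $ 1 + z $ 2 * x"
      define e where "e = h $ 1 + h $ 2 * x"
      have g'_bound: "\<bar>g' (y + t * e)\<bar> \<le> C * (1 + \<bar>x\<bar>) ^ n" if "t \<in> {0..1}" for t
      proof -
        have "\<bar>z $ j + t * h $ j\<bar> \<le> M" for j
        proof -
          have "\<bar>z $ j + t * h $ j\<bar> \<le> \<bar>z $ j\<bar> + \<bar>t\<bar> * \<bar>h $ j\<bar>"
            by (metis abs_mult abs_triangle_ineq)
          also have "\<dots> \<le> norm z + 1 * M0"
            using that M0[of i] component_le_norm_cart[of z j] component_le_norm_cart[of h j]
            by (intro add_mono mult_mono) (auto simp: h_def)
          finally show ?thesis
            by (simp add: M_def)
        qed
        from C[OF this[of 1] this[of 2], of x] show ?thesis
          by (simp add: y_def e_def algebra_simps)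
      qed
      have "\<bar>g (y + 1 * e) - g (y + 0 * e)\<bar> \<le> C * (1 + \<bar>x\<bar>) ^ n * \<bar>e\<bar> * \<bar>1 - 0\<bar>"
      proof (rule field_differentiable_bound[of "{0..1::real}" "\<lambda>t. g (y + t * e)" "\<lambda>t. g' (y + t * e) * e", unfolded real_norm_def])
        fix t :: real assume t: "t \<in> {0..1}"
        show "((\<lambda>t. g (y + t * e)) has_field_derivative g' (y + t * e) * e) (at t within {0..1})"
          by (rule DERIV_chain2[OF deriv]) (auto intro!: derivative_eq_intros)
        show "\<bar>g' (y + t * e) * e\<bar> \<le> C * (1 + \<bar>x\<bar>) ^ n * \<bar>e\<bar>"
          using g'_bound[OF t] by (simp add: abs_mult mult_right_mono)
      qed auto
      moreover have "\<bar>g' y * e\<bar> \<le> C * (1 + \<bar>x\<bar>) ^ n * \<bar>e\<bar>"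
        using g'_bound[of 0] by (simp add: abs_mult mult_right_mono)
      ultimately have "\<bar>g (y + e) - g y - g' y * e\<bar> \<le> 2 * C * (1 + \<bar>x\<bar>) ^ n * \<bar>e\<bar>"
        by simp
      also have "\<dots> \<le> 2 * C * (1 + \<bar>x\<bar>) ^ n * (norm h * (1 + \<bar>x\<bar>))"
      proof (rule mult_left_mono)
        have "\<bar>e\<bar> \<le> \<bar>h $ 1\<bar> + \<bar>h $ 2\<bar> * \<bar>x\<bar>"
          unfolding e_def by (metis abs_mult abs_triangle_ineq)
        also have "\<dots> \<le> norm h + norm h * \<bar>x\<bar>"
          by (intro add_mono mult_right_mono component_le_norm_cart) auto
        finally show "\<bar>e\<bar> \<le> norm h * (1 + \<bar>x\<bar>)"
          by (simp add: algebra_simps)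
      qed (use C0 in auto)
      finally show ?thesis
        unfolding R_def using h by (simp add: h_def[symmetric] y_def e_def field_simps)
    qed
    have R_lim: "(\<lambda>i. R (X i) x) \<longlonglongrightarrow> 0" for x
    proof -
      \<comment> \<open>Pointwise convergence of \<open>R\<close> is differentiability at
        \<open>0\<close> of \<open>g\<close> composed with an affine function of
        \<open>h\<close>.\<close>
      have "((\<lambda>h. g (z $ 1 + z $ 2 * x + (h $ 1 + h $ 2 * x))) has_derivative
          (\<lambda>h. g' (z $ 1 + z $ 2 * x) * (h $ 1 + h $ 2 * x))) (at (0 :: real^2))"
      proof (rule has_derivative_compose[where g = g and g' = "(*) (g' (z $ 1 + z $ 2 * x))"
            and f = "\<lambda>h. z $ 1 + z $ 2 * x + (h $ 1 + h $ 2 * x)" and f' = "\<lambda>h. h $ 1 + h $ 2 * x"])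
        show "((\<lambda>h. z $ 1 + z $ 2 * x + (h $ 1 + h $ 2 * x)) has_derivative
            (\<lambda>h. h $ 1 + h $ 2 * x)) (at (0 :: real^2))"
          by (rule derivative_eq_intros bounded_linear.has_derivative[OF bounded_linear_vec_nth] refl | simp)+
        show "(g has_derivative (*) (g' (z $ 1 + z $ 2 * x)))
            (at (z $ 1 + z $ 2 * x + ((0 :: real^2) $ 1 + (0 :: real^2) $ 2 * x)))"
          using deriv by (simp add: has_field_derivative_def)
      qed
      then have "((\<lambda>h. norm (R h x)) \<longlongrightarrow> 0) (at 0)"
        unfolding has_derivative_at R_def by (simp add: abs_divide)
      then have "((\<lambda>h. R h x) \<longlongrightarrow> 0) (at 0)"
        by (rule tendsto_norm_zero_cancel)
      then show ?thesis
        using X X0 unfolding tendsto_at_iff_sequentially comp_def by blast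
    qed
    have "(\<lambda>i. \<integral>x. std_normal_density x * x ^ k * R (X i) x \<partial>lborel) \<longlonglongrightarrow> (\<integral>x. 0 \<partial>(lborel :: real measure))"
    proof (rule integral_dominated_convergence)
      show "integrable lborel (\<lambda>x. 2 * C * (std_normal_density x * (1 + \<bar>x\<bar>) ^ (Suc n + k)))"
        by (rule integrable_std_normal_poly)
      show "AE x in lborel. norm (std_normal_density x * x ^ k * R (X i) x)
          \<le> 2 * C * (std_normal_density x * (1 + \<bar>x\<bar>) ^ (Suc n + k))" for i
        using weighted_bound[OF R_bound] by auto
      show "AE x in lborel. (\<lambda>i. std_normal_density x * x ^ k * R (X i) x) \<longlonglongrightarrow> 0"
        using tendsto_mult_right_zero[OF R_lim] by auto
    qed (unfold R_def, measurable)
    then have "(\<lambda>i. norm ((gauss_mean k g (z + X i) - gauss_mean k g z - ?D (X i)) / norm (X i))) \<longlonglongrightarrow> 0"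
      unfolding R_int by (intro tendsto_norm_zero) simp
    then show "(\<lambda>i. norm (gauss_mean k g (z + X i) - gauss_mean k g z - ?D (X i)) / norm (X i)) \<longlonglongrightarrow> 0"
      by (simp add: abs_divide)
  qed
qed

text \<open>The partial derivatives are Gaussian means of \<open>g'\<close>, hence continuous and
  bounded on the compact ball; convexity then allows the mean value inequality.\<close>

lemma gauss_mean_lipschitz:
  assumes g: "continuous_on UNIV g" "poly_bounded g"
    and g': "continuous_on UNIV g'" "poly_bounded g'"
    and deriv: "\<And>x. (g has_real_derivative g' x) (at x)"
  obtains L where "L-lipschitz_on (cball p r) (gauss_mean k g)"
proof -
  have "bounded (gauss_mean j g' ` cball p r)" for j
    by (intro compact_imp_bounded compact_continuous_image continuous_at_imp_continuous_on ballI
        gauss_mean_isCont[OF g']) auto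
  then have "\<exists>B. \<forall>z\<in>cball p r. \<bar>gauss_mean j g' z\<bar> \<le> B" for j
    by (fastforce simp: bounded_iff)
  then obtain B where B: "\<And>j z. z \<in> cball p r \<Longrightarrow> \<bar>gauss_mean j g' z\<bar> \<le> B j"
    by metis
  define L where "L = \<bar>B k\<bar> + \<bar>B (Suc k)\<bar>"
  have "norm (gauss_mean k g x - gauss_mean k g y) \<le> L * norm (x - y)"
    if "x \<in> cball p r" "y \<in> cball p r" for x y
  proof (rule differentiable_bound[OF convex_cball _ _ that, where
        f = "gauss_mean k g" and f' = "\<lambda>z (h::real^2). h $ 1 * gauss_mean k g' z + h $ 2 * gauss_mean (Suc k) g' z"])
    fix z assume z: "z \<in> cball p r"
    show "(gauss_mean k g has_derivative
        (\<lambda>h. h $ 1 * gauss_mean k g' z + h $ 2 * gauss_mean (Suc k) g' z)) (at z within cball p r)"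
      by (rule has_derivative_at_withinI[OF gauss_mean_has_derivative[OF assms]])
    show "onorm (\<lambda>h::real^2. h $ 1 * gauss_mean k g' z + h $ 2 * gauss_mean (Suc k) g' z) \<le> L"
    proof (rule onorm_le)
      fix h :: "real^2"
      have "norm (h $ 1 * gauss_mean k g' z + h $ 2 * gauss_mean (Suc k) g' z)
          \<le> \<bar>h $ 1\<bar> * \<bar>gauss_mean k g' z\<bar> + \<bar>h $ 2\<bar> * \<bar>gauss_mean (Suc k) g' z\<bar>"
        by (metis abs_mult abs_triangle_ineq real_norm_def)
      also have "\<dots> \<le> norm h * \<bar>B k\<bar> + norm h * \<bar>B (Suc k)\<bar>"
        using B[OF z, of k] B[OF z, of "Suc k"] component_le_norm_cart[of h]
        by (intro add_mono mult_mono) (auto simp del: mem_cball)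
      finally show "norm (h $ 1 * gauss_mean k g' z + h $ 2 * gauss_mean (Suc k) g' z) \<le> L * norm h"
        by (simp add: L_def algebra_simps)
    qed
  qed
  then show thesis
    by (intro that[of L] lipschitz_onI) (auto simp: dist_norm L_def)
qed

text \<open>Substituting \<open>z $ 1 + z $ 2 * x\<close> for the variable standardizes the density;
  the Jacobian \<open>z $ 2\<close> cancels its normalizing factor.\<close>

lemma smoothing_eq_gauss_mean:
  assumes "z $ 2 > 0"
  shows "smoothing f z = gauss_mean 0 f z"
proof -
  have "smoothing f z = \<bar>z $ 2\<bar> *\<^sub>R (\<integral>x. f (z $ 1 + z $ 2 * x) *
      normal_density (z $ 1) (z $ 2) (z $ 1 + z $ 2 * x) \<partial>lborel)"
    unfolding smoothing_def using assms by (subst lborel_integral_real_affine[of "z $ 2" _ "z $ 1"]) auto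
  also have "\<dots> = (\<integral>x. z $ 2 * (f (z $ 1 + z $ 2 * x) *
      normal_density (z $ 1) (z $ 2) (z $ 1 + z $ 2 * x)) \<partial>lborel)"
    using assms by simp
  also have "\<dots> = gauss_mean 0 f z"
    unfolding gauss_mean_def
    by (intro Bochner_Integration.integral_cong refl)
       (use assms in \<open>simp add: normal_density_def real_sqrt_mult power_mult_distrib field_simps\<close>)
  finally show ?thesis .
qed

lemma gauss_mean_boundary:
  assumes "z $ 2 = 0"
  shows "gauss_mean 0 g z = g (z $ 1)" "gauss_mean 1 g z = 0" "gauss_mean 2 g z = g (z $ 1)"
  using assms integral_std_normal_moment_even[of 0] integral_std_normal_moment_even[of 1]
    integral_std_normal_moment_odd[of 0]
  by (simp_all add: gauss_mean_def)

section \<open>The gradient of the smoothing\<close>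

lemma CkpD:
  assumes "f \<in> Ckp n" "j \<le> n"
  shows "continuous_on UNIV ((deriv ^^ j) f)" and "poly_bounded ((deriv ^^ j) f)"
proof -
  show cont: "continuous_on UNIV ((deriv ^^ j) f)"
    using assms by (auto simp: Ckp_def)
  show "poly_bounded ((deriv ^^ j) f)"
    using assms poly_boundedI[OF cont] by (auto simp: Ckp_def)
qed

lemma Ckp_DERIV:
  assumes "f \<in> Ckp n" "j < n"
  shows "((deriv ^^ j) f has_real_derivative (deriv ^^ Suc j) f x) (at x)"
proof -
  have "(deriv ^^ j) f differentiable (at x)"
    using assms by (auto simp: Ckp_def differentiable_on_def)
  then show ?thesis
    by (simp add: DERIV_deriv_iff_real_differentiable)
qed

text \<open>For \<open>g = f'\<close> this is the formula for the gradient of the smoothing, read on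
  the whole plane.\<close>

definition gauss_field :: "(real \<Rightarrow> real) \<Rightarrow> real^2 \<Rightarrow> real^2" where
  "gauss_field g z = vector [gauss_mean 0 g z, gauss_mean 1 g z]"

text \<open>For \<open>g = f''\<close> this is the Hessian of the smoothing at positive
  \<open>z $ 2\<close>.\<close>

definition gauss_jacobian :: "(real \<Rightarrow> real) \<Rightarrow> real^2 \<Rightarrow> real^2^2" where
  "gauss_jacobian g z = vector [vector [gauss_mean 0 g z, gauss_mean 1 g z],
                                vector [gauss_mean 1 g z, gauss_mean 2 g z]]"

lemma gauss_field_has_derivative:
  assumes g: "continuous_on UNIV g" "poly_bounded g"
    and g': "continuous_on UNIV g'" "poly_bounded g'"
    and deriv: "\<And>x. (g has_real_derivative g' x) (at x)"
  shows "(gauss_field g has_derivative (\<lambda>h. gauss_jacobian g' z *v h)) (at z)"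
proof -
  have eq: "gauss_field g = (\<lambda>z. gauss_mean 0 g z *\<^sub>R axis 1 1 + gauss_mean 1 g z *\<^sub>R axis 2 1)"
    by (auto simp: gauss_field_def fun_eq_iff vec_eq_iff forall_2 axis_def)
  show ?thesis
    unfolding eq
    by (rule derivative_eq_intros gauss_mean_has_derivative[OF assms] refl)+
       (auto simp: gauss_jacobian_def fun_eq_iff vec_eq_iff forall_2 axis_def matrix_vector_mult_def
          sum_2 numeral_2_eq_2)
qed

lemma gauss_field_lipschitz:
  assumes "continuous_on UNIV g" "poly_bounded g" "continuous_on UNIV g'" "poly_bounded g'"
    and "\<And>x. (g has_real_derivative g' x) (at x)"
  obtains L where "L-lipschitz_on (cball p r) (gauss_field g)"
proof -
  obtain L0 where L0: "L0-lipschitz_on (cball p r) (gauss_mean 0 g)"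
    by (rule gauss_mean_lipschitz[OF assms])
  obtain L1 where L1: "L1-lipschitz_on (cball p r) (gauss_mean 1 g)"
    by (rule gauss_mean_lipschitz[OF assms])
  show thesis
  proof (rule that, rule lipschitz_onI)
    fix x y assume xy: "x \<in> cball p r" "y \<in> cball p r"
    have "dist (gauss_field g x) (gauss_field g y) \<le>
        (\<Sum>i\<in>UNIV. \<bar>(gauss_field g x - gauss_field g y) $ i\<bar>)"
      unfolding dist_norm by (rule norm_le_l1_cart)
    also have "\<dots> = dist (gauss_mean 0 g x) (gauss_mean 0 g y) + dist (gauss_mean 1 g x) (gauss_mean 1 g y)"
      by (simp add: sum_2 gauss_field_def dist_norm)
    also have "\<dots> \<le> (L0 + L1) * dist x y"
      using lipschitz_onD[OF L0 xy] lipschitz_onD[OF L1 xy] by (simp add: distrib_right)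
    finally show "dist (gauss_field g x) (gauss_field g y) \<le> (L0 + L1) * dist x y" .
  qed (use lipschitz_on_nonneg[OF L0] lipschitz_on_nonneg[OF L1] in simp)
qed

section \<open>Limits at the boundary of the half-plane\<close>

lemma vector_tendsto_boundary:
  "((\<lambda>\<sigma>. vector [\<mu>, \<sigma>] :: real^2) \<longlongrightarrow> vector [\<mu>, 0]) (at_right 0)"
proof (rule vec_tendstoI)
  fix i :: 2
  show "((\<lambda>\<sigma>. (vector [\<mu>, \<sigma>] :: real^2) $ i) \<longlongrightarrow> (vector [\<mu>, 0] :: real^2) $ i) (at_right 0)"
    using exhaust_2[of i] by auto
qed

lemma gauss_mean_tendsto_boundary:
  assumes "continuous_on UNIV g" "poly_bounded g"
  shows "((\<lambda>\<sigma>. gauss_mean k g (vector [\<mu>, \<sigma>])) \<longlongrightarrow> gauss_mean k g (vector [\<mu>, 0])) (at_right 0)"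
  by (rule isCont_tendsto_compose[OF gauss_mean_isCont[OF assms] vector_tendsto_boundary])

lemma gauss_field_tendsto_boundary:
  assumes "continuous_on UNIV g" "poly_bounded g"
  shows "((\<lambda>\<sigma>. gauss_field g (vector [\<mu>, \<sigma>])) \<longlongrightarrow> gauss_field g (vector [\<mu>, 0])) (at_right 0)"
proof (rule vec_tendstoI)
  fix i :: 2
  show "((\<lambda>\<sigma>. gauss_field g (vector [\<mu>, \<sigma>]) $ i) \<longlongrightarrow> gauss_field g (vector [\<mu>, 0]) $ i) (at_right 0)"
    using exhaust_2[of i] gauss_mean_tendsto_boundary[OF assms] by (auto simp: gauss_field_def)
qed

lemma gauss_jacobian_tendsto_boundary:
  assumes "continuous_on UNIV g" "poly_bounded g"
  shows "((\<lambda>\<sigma>. gauss_jacobian g (vector [\<mu>, \<sigma>])) \<longlongrightarrow>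
    vector [vector [g \<mu>, 0], vector [0, g \<mu>]]) (at_right 0)"
proof (intro vec_tendstoI)
  fix i j :: 2
  have "gauss_jacobian g (vector [\<mu>, 0]) = vector [vector [g \<mu>, 0], vector [0, g \<mu>]]"
    by (simp add: gauss_jacobian_def gauss_mean_boundary[unfolded One_nat_def])
  moreover have "((\<lambda>\<sigma>. gauss_jacobian g (vector [\<mu>, \<sigma>]) $ i $ j) \<longlongrightarrow>
      gauss_jacobian g (vector [\<mu>, 0]) $ i $ j) (at_right 0)"
    using exhaust_2[of i] exhaust_2[of j] gauss_mean_tendsto_boundary[OF assms]
    by (auto simp: gauss_jacobian_def)
  ultimately show "((\<lambda>\<sigma>. gauss_jacobian g (vector [\<mu>, \<sigma>]) $ i $ j) \<longlongrightarrow>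
      vector [vector [g \<mu>, 0], vector [0, g \<mu>]] $ i $ j) (at_right 0)"
    by simp
qed

section \<open>Identification of the extended gradient\<close>

lemma gradient_eqI:
  assumes "GDERIV F z :> D"
  shows "gradient F z = D"
  unfolding gradient_def
proof (rule the_equality)
  show "GDERIV F z :> D"
    by (fact assms)
  fix E assume "GDERIV F z :> E"
  then have "(\<lambda>h. h \<bullet> E) = (\<lambda>h. h \<bullet> D)"
    using assms has_derivative_unique unfolding gderiv_def by blast
  then show "E = D"
    by (metis vector_eq_ldot)
qed

text \<open>The smoothing agrees with \<open>gauss_mean 0 f\<close> on the open upper half-plane, so
  it inherits the derivative there.\<close>

lemma smoothing_GDERIV:
  assumes f: "continuous_on UNIV f" "poly_bounded f"
    and f': "continuous_on UNIV f'" "poly_bounded f'"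
    and deriv: "\<And>x. (f has_real_derivative f' x) (at x)" and "z $ 2 > 0"
  shows "GDERIV (smoothing f) z :> gauss_field f' z"
proof -
  have "(gauss_mean 0 f has_derivative (\<lambda>h. h \<bullet> gauss_field f' z)) (at z)"
    using gauss_mean_has_derivative[OF f f' deriv, of 0 z]
    by (simp add: gauss_field_def inner_vec_def sum_2)
  then have "(smoothing f has_derivative (\<lambda>h. h \<bullet> gauss_field f' z)) (at z)"
    by (rule has_derivative_transform_within_open[where s = "{z. z $ 2 > 0}"])
       (use assms in \<open>auto simp: smoothing_eq_gauss_mean open_halfspace_component_gt_cart\<close>)
  then show ?thesis
    by (simp add: gderiv_def)
qed

text \<open>On the boundary, the limit defining \<open>ext_gradient\<close> is taken along points
  where the gradient equals the continuous \<open>gauss_field f'\<close>, so it is the boundary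
  value of that field.\<close>

lemma ext_gradient_smoothing:
  assumes f: "continuous_on UNIV f" "poly_bounded f"
    and f': "continuous_on UNIV f'" "poly_bounded f'"
    and deriv: "\<And>x. (f has_real_derivative f' x) (at x)" and "z \<in> half_plane"
  shows "ext_gradient (smoothing f) z = gauss_field f' z"
proof (cases "z $ 2 > 0")
  case True
  then show ?thesis
    using gradient_eqI[OF smoothing_GDERIV[OF assms(1-5)]] by (simp add: ext_gradient_def)
next
  case False
  then have z: "z = vector [z $ 1, 0]"
    using \<open>z \<in> half_plane\<close> by (simp add: half_plane_def vec_eq_iff forall_2)
  have "\<forall>\<^sub>F \<sigma> in at_right 0. gauss_field f' (vector [z $ 1, \<sigma>]) =
      gradient (smoothing f) (vector [z $ 1, \<sigma>])"
    using eventually_at_right_less[of 0]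
    by eventually_elim (simp add: gradient_eqI[OF smoothing_GDERIV[OF assms(1-5)]])
  then have "((\<lambda>\<sigma>. gradient (smoothing f) (vector [z $ 1, \<sigma>])) \<longlongrightarrow> gauss_field f' z) (at_right 0)"
    using gauss_field_tendsto_boundary[OF f', of "z $ 1"] unfolding z[symmetric]
    by (rule tendsto_cong[THEN iffD1])
  then show ?thesis
    using False by (simp add: ext_gradient_def tendsto_Lim)
qed

lemma matrix_vector_mult_uminus: "(- A) *v x = - (A *v x)"
  for A :: "real^'n^'m"
  by (simp add: vec_eq_iff matrix_vector_mult_def sum_negf)

section \<open>Linearization and stability at a critical point\<close>

theorem proposition2p12:
  fixes f :: "real \<Rightarrow> real" and xt :: real
  assumes "f \<in> Ckp 4"
    and "deriv f xt = 0"
  shows "gradient_extends (smoothing f) \<and>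
    linearization_at (\<lambda>z. - ext_gradient (smoothing f) z) (vector [xt, 0])
      (- vector [vector [(deriv ^^ 2) f xt, 0],
                 vector [0, (deriv ^^ 2) f xt]]) \<and>
    ((deriv ^^ 2) f xt < 0 \<longrightarrow>
      repelling (\<lambda>z. - ext_gradient (smoothing f) z) half_plane (vector [xt, 0])) \<and>
    ((deriv ^^ 2) f xt > 0 \<longrightarrow>
      attracting (\<lambda>z. - ext_gradient (smoothing f) z) half_plane (vector [xt, 0]))"
proof -
  define f1 where "f1 = deriv f"
  define f2 where "f2 = (deriv ^^ 2) f"
  define p :: "real^2" where "p = vector [xt, 0]"
  define A :: "real^2^2" where "A = vector [vector [f2 xt, 0], vector [0, f2 xt]]"
  have f: "continuous_on UNIV f" "poly_bounded f"
    and f1: "continuous_on UNIV f1" "poly_bounded f1"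
    and f2: "continuous_on UNIV f2" "poly_bounded f2"
    using CkpD[OF assms(1), of 0] CkpD[OF assms(1), of 1] CkpD[OF assms(1), of 2]
    by (simp_all add: f1_def f2_def)
  have df: "\<And>x. (f has_real_derivative f1 x) (at x)" and df1: "\<And>x. (f1 has_real_derivative f2 x) (at x)"
    using Ckp_DERIV[OF assms(1), of 0] Ckp_DERIV[OF assms(1), of 1]
    by (simp_all add: f1_def f2_def numeral_2_eq_2)
  note ext_eq = ext_gradient_smoothing[OF f f1 df]
  have p: "p \<in> half_plane" "p $ 2 = 0"
    by (simp_all add: p_def half_plane_def)
  have field_p: "gauss_field f1 p = 0"
    using assms(2) gauss_mean_boundary[OF p(2), of f1]
    by (simp add: gauss_field_def vec_eq_iff forall_2 p_def f1_def)
  have boundary: "gauss_field f1 z $ 2 = 0" if "z $ 2 = 0" for z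
    using gauss_mean_boundary(2)[OF that] by (simp add: gauss_field_def)
  \<comment> \<open>\<open>A\<close> acts as a scalar, which is the shape of derivative that
    \<open>attracting_half_planeI\<close> requires.\<close>
  have A_mult: "A *v h = f2 xt *\<^sub>R h" for h
    by (simp add: A_def vec_eq_iff forall_2 matrix_vector_mult_def sum_2)
  have "gauss_jacobian f2 p = A"
    using gauss_mean_boundary[OF p(2), of f2] by (simp add: gauss_jacobian_def A_def p_def)
  then have field_deriv: "(gauss_field f1 has_derivative (\<lambda>h. A *v h)) (at p)"
    using gauss_field_has_derivative[OF f1 f2 df1, of p] by simp
  obtain L where L: "L-lipschitz_on (cball p 1) (gauss_field f1)"
    by (rule gauss_field_lipschitz[OF f1 f2 df1])
  have "gradient_extends (smoothing f)"
    unfolding gradient_extends_def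
  proof (intro conjI allI impI)
    fix \<mu> \<sigma> :: real assume "\<sigma> > 0"
    then show "GDERIV (smoothing f) (vector [\<mu>, \<sigma>]) :> ext_gradient (smoothing f) (vector [\<mu>, \<sigma>])"
      using smoothing_GDERIV[OF f f1 df, of "vector [\<mu>, \<sigma>]"] ext_eq[of "vector [\<mu>, \<sigma>]"]
      by (simp add: half_plane_def)
  next
    fix \<mu> :: real
    have "\<forall>\<^sub>F \<sigma> in at_right 0. gauss_field f1 (vector [\<mu>, \<sigma>]) = ext_gradient (smoothing f) (vector [\<mu>, \<sigma>])"
      using eventually_at_right_less[of 0] by eventually_elim (simp add: ext_eq half_plane_def)
    then show "((\<lambda>\<sigma>. ext_gradient (smoothing f) (vector [\<mu>, \<sigma>])) \<longlongrightarrow>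
        ext_gradient (smoothing f) (vector [\<mu>, 0])) (at_right 0)"
      using gauss_field_tendsto_boundary[OF f1, of \<mu>] ext_eq[of "vector [\<mu>, 0]"]
      by (simp add: half_plane_def tendsto_cong)
  qed
  moreover have "linearization_at (\<lambda>z. - ext_gradient (smoothing f) z) p (- A)"
    unfolding linearization_at_def
  proof (intro conjI exI allI impI)
    show "- ext_gradient (smoothing f) p = 0"
      using ext_eq[OF p(1)] field_p by simp
    \<comment> \<open>The two-sided derivative of \<open>gauss_field f1\<close> at \<open>p\<close>
      is restricted to the half-plane, where the field coincides with the extended gradient.\<close>
    show "((\<lambda>z. - ext_gradient (smoothing f) z) has_derivative (\<lambda>h. - A *v h)) (at p within half_plane)"
      unfolding matrix_vector_mult_uminus
      by (rule has_derivative_minus, rule has_derivative_transform[OF p(1) ext_eq])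
         (auto intro: has_derivative_at_withinI[OF field_deriv])
    show "((\<lambda>\<sigma>. - gauss_jacobian f2 (vector [p $ 1, \<sigma>])) \<longlongrightarrow> - A) (at_right 0)"
      using gauss_jacobian_tendsto_boundary[OF f2, of xt]
      by (intro tendsto_minus) (simp add: A_def p_def)
    fix \<sigma> :: real assume "\<sigma> > 0"
    have "(ext_gradient (smoothing f) has_derivative (\<lambda>h. gauss_jacobian f2 (vector [p $ 1, \<sigma>]) *v h))
        (at (vector [p $ 1, \<sigma>]))"
      by (rule has_derivative_transform_within_open[where s = "{z. z $ 2 > 0}",
            OF gauss_field_has_derivative[OF f1 f2 df1]])
         (use \<open>\<sigma> > 0\<close> in \<open>auto simp: ext_eq half_plane_def open_halfspace_component_gt_cart\<close>)
    then show "((\<lambda>z. - ext_gradient (smoothing f) z) has_derivative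
        (\<lambda>h. - gauss_jacobian f2 (vector [p $ 1, \<sigma>]) *v h)) (at (vector [p $ 1, \<sigma>]))"
      unfolding matrix_vector_mult_uminus by (rule has_derivative_minus)
  qed
  moreover have "repelling (\<lambda>z. - ext_gradient (smoothing f) z) half_plane p" if "f2 xt < 0"
    unfolding repelling_def
  \<comment> \<open>Time reversal cancels the minus sign of the gradient flow, so the field is
    \<open>gauss_field f1\<close> itself, contracting at the positive rate
    \<open>- f2 xt\<close>.\<close>
  proof (rule attracting_half_planeI[where H = "gauss_field f1" and lam = "- f2 xt", OF zero_less_one L])
    show "(gauss_field f1 has_derivative (\<lambda>h. - (- f2 xt) *\<^sub>R h)) (at p)"
      using field_deriv by (simp add: A_mult)
  qed (use that field_p p boundary ext_eq in auto)
  moreover have "attracting (\<lambda>z. - ext_gradient (smoothing f) z) half_plane p" if "f2 xt > 0"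
  proof (rule attracting_half_planeI[where H = "\<lambda>z. - gauss_field f1 z" and lam = "f2 xt", OF zero_less_one])
    show "L-lipschitz_on (cball p 1) (\<lambda>z. - gauss_field f1 z)"
      using L by (simp add: lipschitz_on_def dist_minus)
    show "((\<lambda>z. - gauss_field f1 z) has_derivative (\<lambda>h. - f2 xt *\<^sub>R h)) (at p)"
      using has_derivative_minus[OF field_deriv] by (simp add: A_mult)
  qed (use that field_p p boundary ext_eq in auto)
  ultimately show ?thesis
    by (simp add: p_def A_def f2_def)
qed

end
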